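(* Let $X$ be an $n\times p$ random matrix whose rows are i.i.d. copies of a random row vector $X_0\in\mathbb{R}^p$, let $\hat\Sigma:=X^TX/n$, $\Sigma_0:=\mathbb{E}X_0^TX_0$, $W:=\hat\Sigma-\Sigma_0$, and assume $\Theta_0:=\Sigma_0^{-1}$ exists. Let $\underline\lambda>0$, let $\hat\Theta$ be the square-root node-wise Lasso estimator with associated diagonal matrix $\tilde\tau$ as defined in the context, and let $$\hat\Theta_{\text{de-sparse}}:=\hat\Theta+\hat\Theta^T-\hat\Theta^T\hat\Sigma\hat\Theta$$ be the de-sparsified node-wise Lasso. Then there are matrices $\mathrm{rem}_1,\mathrm{rem}_2$ with $$\hat\Theta_{\text{de-sparse}}-\Theta_0=-\Theta_0W\Theta_0-\mathrm{rem}_1-\mathrm{rem}_2,$$ where $$\|\mathrm{rem}_1\|_\infty\le\|\Theta_0W\|_\infty\,|||\hat\Theta-\Theta_0|||_1,\qquad\|\mathrm{rem}_2\|_\infty\le\underline\lambda\,\|\tilde\tau^{-1}\|_\infty\,|||\hat\Theta-\Theta_0|||_1 .$$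
   Context: For $v\in\mathbb{R}^n$, $\|v\|_n:=\sqrt{v^Tv/n}$. For a matrix $A$, $\|A\|_\infty:=\max_{k,j}|A_{k,j}|$ and $|||A|||_1:=\max_j\sum_k|A_{k,j}|$. $X_j$ is the $j$-th column of $X$ and $X_{-j}$ the $n\times(p-1)$ matrix of the other columns. For $j=1,\dots,p$, $\hat\gamma_j$ is a minimizer over $\gamma_j\in\mathbb{R}^{p-1}$ of $\|X_j-X_{-j}\gamma_j\|_n+\underline\lambda\|\gamma_j\|_1$, with entries $\hat\gamma_{k,j}$, $k\ne j$. Put $\hat\tau_j:=\|X_j-X_{-j}\hat\gamma_j\|_n$, assumed nonzero, $\tilde\tau_j^2:=\hat\tau_j^2+\underline\lambda\hat\tau_j\|\hat\gamma_j\|_1$ with $\tilde\tau_j>0$, and $\tilde\tau:=\mathrm{diag}(\tilde\tau_1,\dots,\tilde\tau_p)$. Let $\hat C$ be the $p\times p$ matrix with $\hat C_{j,j}=1$ and $\hat C_{k,j}=-\hat\gamma_{k,j}$ for $k\ne j$, and $\hat\Theta:=\hat C\tilde\tau^{-2}$. *)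

theory Defs
  imports "HOL-Probability.Probability"
begin

text \<open>An \<open>n \<times> p\<close> matrix is a \<^typ>\<open>real^'p^'n\<close>, with \<open>n = CARD('n)\<close> and \<open>p = CARD('p)\<close>;
  \<open>A $ k $ j\<close> is the entry in row \<open>k\<close> and column \<open>j\<close>.\<close>

definition norm_n :: "real^'n \<Rightarrow> real" where
  "norm_n v = sqrt ((v \<bullet> v) / real CARD('n))"

definition max_norm :: "real^'c^'r \<Rightarrow> real" where
  "max_norm A = Max {\<bar>A $ k $ j\<bar> | k j. True}"

definition col_sum_norm :: "real^'c^'r \<Rightarrow> real" where
  "col_sum_norm A = Max {(\<Sum>k\<in>UNIV. \<bar>A $ k $ j\<bar>) | j. True}"

definition diag_mat :: "('p \<Rightarrow> real) \<Rightarrow> real^'p^'p" where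
  "diag_mat d = (\<chi> k j. if k = j then d j else 0)"

definition gram :: "real^'p^'n \<Rightarrow> real^'p^'p" where
  "gram X = (1 / real CARD('n)) *\<^sub>R (transpose X ** X)"

definition second_moment :: "'v measure \<Rightarrow> ('v \<Rightarrow> real^'p) \<Rightarrow> real^'p^'p" where
  "second_moment N X0 = (\<chi> k l. \<integral>\<omega>. X0 \<omega> $ k * X0 \<omega> $ l \<partial>N)"

text \<open>The space \<open>\<real>\<^sup>p\<^sup>-\<^sup>1\<close> of coefficient vectors for node \<open>j\<close>, whose coordinates are indexed by the
  \<open>k \<noteq> j\<close>, is the set of functions \<open>extensional (- {j})\<close>; the value such a function
  takes at \<open>j\<close> itself is a dummy.\<close>

definition node_residual :: "real^'p^'n \<Rightarrow> 'p \<Rightarrow> ('p \<Rightarrow> real) \<Rightarrow> real^'n" where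
  "node_residual X j \<gamma> = column j X - (\<Sum>k\<in>- {j}. \<gamma> k *\<^sub>R column k X)"

definition node_l1 :: "'p::finite \<Rightarrow> ('p \<Rightarrow> real) \<Rightarrow> real" where
  "node_l1 j \<gamma> = (\<Sum>k\<in>- {j}. \<bar>\<gamma> k\<bar>)"

definition is_sqrt_node_lasso :: "real \<Rightarrow> real^'p^'n \<Rightarrow> 'p \<Rightarrow> ('p \<Rightarrow> real) \<Rightarrow> bool" where
  "is_sqrt_node_lasso lam X j \<gamma> \<longleftrightarrow>
     is_arg_min (\<lambda>\<beta>. norm_n (node_residual X j \<beta>) + lam * node_l1 j \<beta>)
       (\<lambda>\<beta>. \<beta> \<in> extensional (- {j})) \<gamma>"

text \<open>In the remaining definitions \<open>\<gamma> j\<close> is the coefficient vector of node \<open>j\<close>, so the entry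
  \<open>\<gamma>\<^bsub>k,j\<^esub>\<close> is \<open>\<gamma> j k\<close>.\<close>

definition tau_hat :: "real^'p^'n \<Rightarrow> ('p \<Rightarrow> 'p \<Rightarrow> real) \<Rightarrow> 'p \<Rightarrow> real" where
  "tau_hat X \<gamma> j = norm_n (node_residual X j (\<gamma> j))"

definition tau_tilde :: "real \<Rightarrow> real^'p^'n \<Rightarrow> ('p \<Rightarrow> 'p \<Rightarrow> real) \<Rightarrow> 'p \<Rightarrow> real" where
  "tau_tilde lam X \<gamma> j = sqrt ((tau_hat X \<gamma> j)\<^sup>2 + lam * tau_hat X \<gamma> j * node_l1 j (\<gamma> j))"

definition tau_tilde_mat :: "real \<Rightarrow> real^'p^'n \<Rightarrow> ('p \<Rightarrow> 'p \<Rightarrow> real) \<Rightarrow> real^'p^'p" where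
  "tau_tilde_mat lam X \<gamma> = diag_mat (tau_tilde lam X \<gamma>)"

definition C_hat :: "('p \<Rightarrow> 'p \<Rightarrow> real) \<Rightarrow> real^'p^'p" where
  "C_hat \<gamma> = (\<chi> k j. if k = j then 1 else - \<gamma> j k)"

definition Theta_hat :: "real \<Rightarrow> real^'p^'n \<Rightarrow> ('p \<Rightarrow> 'p \<Rightarrow> real) \<Rightarrow> real^'p^'p" where
  "Theta_hat lam X \<gamma> =
     C_hat \<gamma> ** matrix_inv (tau_tilde_mat lam X \<gamma> ** tau_tilde_mat lam X \<gamma>)"

definition Theta_desparse :: "real \<Rightarrow> real^'p^'n \<Rightarrow> ('p \<Rightarrow> 'p \<Rightarrow> real) \<Rightarrow> real^'p^'p" where
  "Theta_desparse lam X \<gamma> =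
     Theta_hat lam X \<gamma> + transpose (Theta_hat lam X \<gamma>)
       - transpose (Theta_hat lam X \<gamma>) ** gram X ** Theta_hat lam X \<gamma>"

end

theory Submission
  imports Defs
begin

text \<open>Write \<open>S\<close> for the Gram matrix, \<open>C\<close> for \<^const>\<open>C_hat\<close>, \<open>T\<close> for \<^const>\<open>Theta_hat\<close>, and \<open>t\<^sub>j\<close>, \<open>u\<^sub>j\<close> for
  the values of \<^const>\<open>tau_hat\<close> and \<^const>\<open>tau_tilde\<close> at \<open>j\<close>. Stationarity of the square-root Lasso
  bounds the off-diagonal entries of \<open>S C\<close> in column \<open>j\<close> by \<open>\<lambda> t\<^sub>j \<le> \<lambda> u\<^sub>j\<close> and makes the diagonal
  entry exactly \<open>u\<^sub>j\<^sup>2\<close>. Hence \<open>S T - I\<close> has zero diagonal and entries bounded by \<open>\<lambda> / u\<^sub>j\<close>. Since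
  \<open>\<Theta>\<^sub>0\<close> and \<open>W\<close> are symmetric, the remainders are \<open>(T - \<Theta>\<^sub>0)\<^sup>T W \<Theta>\<^sub>0\<close> and \<open>(S T - I)\<^sup>T (T - \<Theta>\<^sub>0)\<close>.\<close>

section \<open>Inequalities for the norms\<close>

lemma norm_n_nonneg: "0 \<le> norm_n v"
  by (simp add: norm_n_def)

lemma norm_n_square: "(norm_n (v :: real^'n))\<^sup>2 = (v \<bullet> v) / real CARD('n)"
  by (simp add: norm_n_def)

lemma abs_entry_le_max_norm: "\<bar>A $ k $ j\<bar> \<le> max_norm A" for A :: "real^'c^'r"
proof -
  have "{\<bar>A $ k $ j\<bar> | k j. True} = (\<lambda>(k, j). \<bar>A $ k $ j\<bar>) ` UNIV"
    by auto
  then show ?thesis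
    unfolding max_norm_def by (intro Max_ge) auto
qed

lemma max_norm_le: "(\<And>k j. \<bar>A $ k $ j\<bar> \<le> c) \<Longrightarrow> max_norm A \<le> c" for A :: "real^'c^'r"
proof -
  assume bound: "\<And>k j. \<bar>A $ k $ j\<bar> \<le> c"
  have "{\<bar>A $ k $ j\<bar> | k j. True} = (\<lambda>(k, j). \<bar>A $ k $ j\<bar>) ` UNIV"
    by auto
  then show ?thesis
    unfolding max_norm_def by (subst Max_le_iff) (auto simp: bound)
qed

lemma max_norm_nonneg: "0 \<le> max_norm A"
  using abs_entry_le_max_norm[of A undefined undefined] by linarith

lemma max_norm_transpose: "max_norm (transpose A) = max_norm A"
  by (rule antisym; rule max_norm_le)
    (use abs_entry_le_max_norm[of A] abs_entry_le_max_norm[of "transpose A"] in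
      \<open>auto simp: transpose_def\<close>)

lemma sum_abs_column_le_col_sum_norm:
  "(\<Sum>k\<in>UNIV. \<bar>A $ k $ j\<bar>) \<le> col_sum_norm A" for A :: "real^'c^'r"
proof -
  have "{(\<Sum>k\<in>UNIV. \<bar>A $ k $ j\<bar>) | j. True} = range (\<lambda>j. \<Sum>k\<in>UNIV. \<bar>A $ k $ j\<bar>)"
    by auto
  then show ?thesis
    unfolding col_sum_norm_def by (intro Max_ge) auto
qed

lemma col_sum_norm_nonneg: "0 \<le> col_sum_norm A"
proof -
  have "0 \<le> (\<Sum>k\<in>UNIV. \<bar>A $ k $ undefined\<bar>)"
    by (simp add: sum_nonneg)
  also have "\<dots> \<le> col_sum_norm A"
    by (rule sum_abs_column_le_col_sum_norm)
  finally show ?thesis .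
qed

text \<open>Hoelder's inequality for a row of \<open>A\<close> (sup norm) against a column of
  \<open>B\<close> (l1 norm). Both remainder bounds come from this product form.\<close>

lemma max_norm_matrix_mult_le:
  fixes A :: "real^'c^'r" and B :: "real^'d^'c"
  shows "max_norm (A ** B) \<le> max_norm A * col_sum_norm B"
proof (rule max_norm_le)
  fix k j
  have "\<bar>(A ** B) $ k $ j\<bar> \<le> (\<Sum>i\<in>UNIV. \<bar>A $ k $ i\<bar> * \<bar>B $ i $ j\<bar>)"
    unfolding matrix_matrix_mult_def by (simp add: abs_mult[symmetric])
  also have "\<dots> \<le> (\<Sum>i\<in>UNIV. max_norm A * \<bar>B $ i $ j\<bar>)"
    by (intro sum_mono mult_right_mono abs_entry_le_max_norm) simp
  also have "\<dots> = max_norm A * (\<Sum>i\<in>UNIV. \<bar>B $ i $ j\<bar>)"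
    by (simp add: sum_distrib_left)
  also have "\<dots> \<le> max_norm A * col_sum_norm B"
    by (intro mult_left_mono sum_abs_column_le_col_sum_norm max_norm_nonneg)
  finally show "\<bar>(A ** B) $ k $ j\<bar> \<le> max_norm A * col_sum_norm B" .
qed

section \<open>Matrix algebra, inverses and diagonal matrices\<close>

lemma transpose_diff: "transpose (A - B) = transpose A - transpose B"
  for A B :: "'a::ab_group_add^'c^'r"
  by (simp add: transpose_def vec_eq_iff)

lemma matrix_diff_ldistrib: "A ** (B - C) = A ** B - A ** C" for A :: "'a::ring_1^'c^'r"
  by (simp add: vec_eq_iff matrix_matrix_mult_def right_diff_distrib sum_subtractf)

lemma matrix_diff_rdistrib: "(A - B) ** C = A ** C - B ** C" for A :: "'a::ring_1^'c^'r"
  by (simp add: vec_eq_iff matrix_matrix_mult_def left_diff_distrib sum_subtractf)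

lemma
  fixes A :: "'a::semiring_1^'n^'m"
  assumes "invertible A"
  shows matrix_inv_right: "A ** matrix_inv A = mat 1"
    and matrix_inv_left: "matrix_inv A ** A = mat 1"
proof -
  have "A ** matrix_inv A = mat 1 \<and> matrix_inv A ** A = mat 1"
    using assms unfolding invertible_def matrix_inv_def by (rule someI_ex)
  then show "A ** matrix_inv A = mat 1" "matrix_inv A ** A = mat 1"
    by auto
qed

text \<open>A one-sided inverse of a square real matrix is two-sided, so checking a right inverse
  suffices to identify \<open>matrix_inv\<close>.\<close>

lemma matrix_inv_unique:
  fixes A B :: "real^'p^'p"
  assumes "A ** B = mat 1"
  shows "matrix_inv A = B"
proof -
  have "invertible A"
    using assms invertible_right_inverse by blast
  then have "matrix_inv A ** A = mat 1"
    using matrix_inv_left by blast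
  then have "matrix_inv A ** A ** B = B"
    by simp
  then show ?thesis
    using assms by (simp add: matrix_mul_assoc[symmetric])
qed

lemma transpose_matrix_inv_symmetric:
  fixes A :: "real^'p^'p"
  assumes "invertible A" "transpose A = A"
  shows "transpose (matrix_inv A) = matrix_inv A"
proof -
  have "A ** transpose (matrix_inv A) = transpose (matrix_inv A ** A)"
    using assms(2) by (simp add: matrix_transpose_mul)
  also have "\<dots> = mat 1"
    using assms(1) by (simp add: matrix_inv_left)
  finally show ?thesis
    using matrix_inv_unique by metis
qed

lemma matrix_mult_diag_mat: "(A ** diag_mat d) $ k $ j = A $ k $ j * d j"
  by (simp add: matrix_matrix_mult_def diag_mat_def if_distrib[of "(*) _"] cong: if_cong)

lemma diag_mat_mult: "diag_mat d ** diag_mat e = diag_mat (\<lambda>j. d j * e j)"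
  by (simp add: vec_eq_iff matrix_mult_diag_mat) (simp add: diag_mat_def)

lemma matrix_inv_diag_mat:
  assumes "\<And>j. d j \<noteq> 0"
  shows "matrix_inv (diag_mat d) = diag_mat (\<lambda>j. 1 / d j)"
  by (rule matrix_inv_unique) (use assms in \<open>simp add: diag_mat_mult\<close>, simp add: diag_mat_def mat_def)

section \<open>The Gram matrix and its product with \<open>C_hat\<close>\<close>

lemma transpose_gram: "transpose (gram X) = gram X"
  by (simp add: gram_def transpose_scalar matrix_transpose_mul)

lemma transpose_second_moment: "transpose (second_moment N X0) = second_moment N X0"
  by (simp add: second_moment_def transpose_def vec_eq_iff mult.commute)

text \<open>Column \<open>j\<close> of \<open>X ** C_hat \<gamma>\<close> is the residual of node
  \<open>j\<close>. The entries of the product are thus the column-residual inner products that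
  optimality of the Lasso controls.\<close>

lemma gram_mult_C_hat:
  fixes X :: "real^'p^'n"
  shows "(gram X ** C_hat \<gamma>) $ k $ j
    = (column k X \<bullet> node_residual X j (\<gamma> j)) / real CARD('n)"
proof -
  have "(X ** C_hat \<gamma>) $ i $ j = node_residual X j (\<gamma> j) $ i" for i
  proof -
    have "(X ** C_hat \<gamma>) $ i $ j
        = X $ i $ j * C_hat \<gamma> $ j $ j + (\<Sum>l\<in>UNIV - {j}. X $ i $ l * C_hat \<gamma> $ l $ j)"
      unfolding matrix_matrix_mult_def by (simp add: sum.remove[of _ j])
    also have "(\<Sum>l\<in>UNIV - {j}. X $ i $ l * C_hat \<gamma> $ l $ j) = - (\<Sum>l\<in>- {j}. \<gamma> j l * X $ i $ l)"
      unfolding sum_negf[symmetric] by (intro sum.cong) (auto simp: C_hat_def)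
    finally show ?thesis
      by (simp add: node_residual_def C_hat_def column_def)
  qed
  then have "column k X \<bullet> node_residual X j (\<gamma> j) = (transpose X ** (X ** C_hat \<gamma>)) $ k $ j"
    by (subst matrix_matrix_mult_def) (simp add: inner_vec_def transpose_def column_def)
  then show ?thesis
    by (simp add: gram_def scalar_matrix_assoc[symmetric] matrix_mul_assoc)
qed

section \<open>Stationarity conditions of the square-root Lasso\<close>

text \<open>First-order optimality in direction \<open>v\<close>. No derivative of the square root is needed, because
  \<open>b \<le> (a\<^sup>2 + b\<^sup>2) / (2 a)\<close> for \<open>a > 0\<close> linearises the norm.\<close>

lemma inner_le_if_norm_n_le:
  fixes r v :: "real^'n"
  assumes pos: "0 < norm_n r"
    and le: "\<And>s. 0 < s \<Longrightarrow> s < 1 \<Longrightarrow> norm_n r \<le> norm_n (r - s *\<^sub>R v) + s * c"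
  shows "(r \<bullet> v) / real CARD('n) \<le> c * norm_n r"
proof -
  define a where "a = norm_n r"
  define q where "q = (r \<bullet> v) / real CARD('n)"
  define w where "w = (norm_n v)\<^sup>2"
  have a: "0 < a"
    using pos by (simp add: a_def)
  have step: "2 * (q - c * a) \<le> s * w" if s: "0 < s" "s < 1" for s
  proof -
    define b where "b = norm_n (r - s *\<^sub>R v)"
    have b2: "b\<^sup>2 = a\<^sup>2 - 2 * s * q + s\<^sup>2 * w"
      unfolding a_def b_def q_def w_def norm_n_square
      by (simp add: inner_diff_left inner_diff_right inner_commute power2_eq_square
          add_divide_distrib diff_divide_distrib)
    \<comment> \<open>Multiplying the hypothesis by \<open>2 * a\<close> prepares for the
      linearisation. After substituting \<open>b2\<close> the squares of \<open>a\<close> cancel,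
      and dividing by \<open>s\<close> leaves an error of order \<open>s\<close>, which vanishes in
      the limit below.\<close>
    have "2 * a * a \<le> 2 * a * (b + s * c)"
      using le[OF s] a by (intro mult_left_mono) (auto simp: a_def b_def)
    moreover have "2 * a * b \<le> a\<^sup>2 + b\<^sup>2"
      by (rule sum_squares_bound)
    ultimately have "s * (2 * (q - c * a)) \<le> s * (s * w)"
      unfolding b2 by (simp add: algebra_simps power2_eq_square)
    then show ?thesis
      using s by simp
  qed
  have "((\<lambda>s. s * w) \<longlongrightarrow> 0 * w) (at_right 0)"
    by (intro tendsto_intros)
  moreover have "\<forall>\<^sub>F s in at_right 0. 2 * (q - c * a) \<le> s * w"
    using step by (auto simp: eventually_at_right_field intro!: exI[of _ 1])
  ultimately have "2 * (q - c * a) \<le> 0 * w"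
    by (intro tendsto_lowerbound) auto
  then show ?thesis
    by (simp add: a_def q_def)
qed

lemma sqrt_node_lasso_minimal:
  assumes "is_sqrt_node_lasso lam X j \<gamma>" "\<beta> \<in> extensional (- {j})"
  shows "norm_n (node_residual X j \<gamma>) + lam * node_l1 j \<gamma>
    \<le> norm_n (node_residual X j \<beta>) + lam * node_l1 j \<beta>"
  using assms unfolding is_sqrt_node_lasso_def is_arg_min_def by force

text \<open>Moving only coordinate \<open>k\<close> by \<open>s\<close> shifts the residual by
  \<open>s\<close> times column \<open>k\<close> and raises the l1 norm by at most the absolute
  value of \<open>s\<close>. The two signs of \<open>s\<close> together bound the absolute
  value.\<close>

lemma sqrt_node_lasso_inner_column_le:
  fixes X :: "real^'p^'n"
  assumes lasso: "is_sqrt_node_lasso lam X j \<gamma>" and "0 \<le> lam"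
    and pos: "0 < norm_n (node_residual X j \<gamma>)" and "k \<noteq> j"
  shows "\<bar>node_residual X j \<gamma> \<bullet> column k X\<bar> / real CARD('n)
    \<le> lam * norm_n (node_residual X j \<gamma>)"
proof -
  have ext: "\<gamma> \<in> extensional (- {j})"
    using lasso by (auto simp: is_sqrt_node_lasso_def is_arg_min_def)
  have "norm_n (node_residual X j \<gamma>)
      \<le> norm_n (node_residual X j \<gamma> - s *\<^sub>R column k X) + \<bar>s\<bar> * lam" for s
  proof -
    define \<beta> where "\<beta> = \<gamma>(k := \<gamma> k + s)"
    have k: "k \<in> - {j}"
      using \<open>k \<noteq> j\<close> by simp
    have "(\<Sum>l\<in>- {j} - {k}. \<beta> l *\<^sub>R column l X) = (\<Sum>l\<in>- {j} - {k}. \<gamma> l *\<^sub>R column l X)"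
      "(\<Sum>l\<in>- {j} - {k}. \<bar>\<beta> l\<bar>) = (\<Sum>l\<in>- {j} - {k}. \<bar>\<gamma> l\<bar>)"
      by (auto intro!: sum.cong simp: \<beta>_def)
    then have res: "node_residual X j \<beta> = node_residual X j \<gamma> - s *\<^sub>R column k X"
      and "node_l1 j \<beta> \<le> node_l1 j \<gamma> + \<bar>s\<bar>"
      by (auto simp: node_residual_def node_l1_def sum.remove[OF _ k] \<beta>_def scaleR_add_left)
    then have "lam * node_l1 j \<beta> \<le> lam * node_l1 j \<gamma> + \<bar>s\<bar> * lam"
      using mult_left_mono[OF _ \<open>0 \<le> lam\<close>] by (fastforce simp: algebra_simps)
    moreover have "\<beta> \<in> extensional (- {j})"
      using ext k by (auto simp: \<beta>_def extensional_def)
    ultimately show ?thesis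
      using sqrt_node_lasso_minimal[OF lasso, of \<beta>] res by auto
  qed
  note perturb = this
  have "(node_residual X j \<gamma> \<bullet> column k X) / real CARD('n)
      \<le> lam * norm_n (node_residual X j \<gamma>)"
    by (rule inner_le_if_norm_n_le[OF pos]) (metis perturb abs_of_pos)
  moreover have "(node_residual X j \<gamma> \<bullet> (- column k X)) / real CARD('n)
      \<le> lam * norm_n (node_residual X j \<gamma>)"
  proof (rule inner_le_if_norm_n_le[OF pos])
    fix s :: real assume "0 < s"
    then show "norm_n (node_residual X j \<gamma>)
        \<le> norm_n (node_residual X j \<gamma> - s *\<^sub>R (- column k X)) + s * lam"
      using perturb[of "- s"] by simp
  qed
  ultimately show ?thesis
    by (auto simp: abs_if)
qed

text \<open>Perturbing along \<open>\<gamma>\<close> itself makes the penalty differentiable, so both directions give an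
  equality.\<close>

lemma sqrt_node_lasso_inner_fitted:
  fixes X :: "real^'p^'n"
  assumes lasso: "is_sqrt_node_lasso lam X j \<gamma>"
    and pos: "0 < norm_n (node_residual X j \<gamma>)"
  shows "(node_residual X j \<gamma> \<bullet> (\<Sum>k\<in>- {j}. \<gamma> k *\<^sub>R column k X)) / real CARD('n)
    = lam * node_l1 j \<gamma> * norm_n (node_residual X j \<gamma>)"
proof -
  define v where "v = (\<Sum>k\<in>- {j}. \<gamma> k *\<^sub>R column k X)"
  have perturb: "norm_n (node_residual X j \<gamma>)
      \<le> norm_n (node_residual X j \<gamma> - s *\<^sub>R v) + s * (lam * node_l1 j \<gamma>)" if "- 1 < s" for s
  proof -
    \<comment> \<open>Scaling could alter the dummy value at \<open>j\<close>;
      \<open>restrict\<close> resets it, so that \<open>\<beta>\<close> stays an admissible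
      competitor.\<close>
    define \<beta> where "\<beta> = restrict (\<lambda>k. (1 + s) * \<gamma> k) (- {j})"
    have "(\<Sum>k\<in>- {j}. \<beta> k *\<^sub>R column k X) = (1 + s) *\<^sub>R v"
      unfolding v_def scaleR_sum_right by (auto intro!: sum.cong simp: \<beta>_def)
    then have "node_residual X j \<beta> = node_residual X j \<gamma> - s *\<^sub>R v"
      by (simp add: node_residual_def v_def[symmetric] scaleR_add_left)
    moreover have "node_l1 j \<beta> = (1 + s) * node_l1 j \<gamma>"
      unfolding node_l1_def sum_distrib_left
      using that by (auto intro!: sum.cong simp: \<beta>_def abs_mult)
    moreover have "\<beta> \<in> extensional (- {j})"
      by (simp add: \<beta>_def)
    ultimately show ?thesis
      using sqrt_node_lasso_minimal[OF lasso, of \<beta>] by (simp add: distrib_left distrib_right mult_ac)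
  qed
  have "(node_residual X j \<gamma> \<bullet> v) / real CARD('n)
      \<le> (lam * node_l1 j \<gamma>) * norm_n (node_residual X j \<gamma>)"
    by (rule inner_le_if_norm_n_le[OF pos]) (simp add: perturb)
  \<comment> \<open>Shrinking \<gamma> lowers the penalty at the same rate, hence the negative
    slope. With \<open>s < 1\<close> the factor \<open>1 - s\<close> stays positive, so the l1 norm
    scales linearly.\<close>
  moreover have "(node_residual X j \<gamma> \<bullet> (- v)) / real CARD('n)
      \<le> (- (lam * node_l1 j \<gamma>)) * norm_n (node_residual X j \<gamma>)"
  proof (rule inner_le_if_norm_n_le[OF pos])
    fix s :: real assume "s < 1"
    then show "norm_n (node_residual X j \<gamma>)
        \<le> norm_n (node_residual X j \<gamma> - s *\<^sub>R (- v)) + s * (- (lam * node_l1 j \<gamma>))"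
      using perturb[of "- s"] by simp
  qed
  ultimately show ?thesis
    by (simp add: v_def)
qed

section \<open>\<open>Theta_hat\<close> as an approximate inverse of the Gram matrix\<close>

lemma tau_hat_le_tau_tilde:
  assumes "0 \<le> lam"
  shows "tau_hat X \<gamma> j \<le> tau_tilde lam X \<gamma> j"
proof -
  have "0 \<le> lam * tau_hat X \<gamma> j * node_l1 j (\<gamma> j)"
    using assms by (simp add: tau_hat_def norm_n_nonneg node_l1_def sum_nonneg)
  then show ?thesis
    unfolding tau_tilde_def by (intro real_le_rsqrt) simp
qed

text \<open>Column \<open>j\<close> is residual plus fit. The residual contributes the square of
  \<open>tau_hat\<close>, and stationarity along \<gamma> makes the fit contribute exactly the
  penalty term in \<open>tau_tilde\<close>.\<close>

lemma sqrt_node_lasso_inner_own_column: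
  fixes X :: "real^'p^'n"
  assumes lasso: "is_sqrt_node_lasso lam X j (\<gamma> j)" and "0 \<le> lam"
    and pos: "0 < tau_hat X \<gamma> j"
  shows "(column j X \<bullet> node_residual X j (\<gamma> j)) / real CARD('n) = (tau_tilde lam X \<gamma> j)\<^sup>2"
proof -
  define r where "r = node_residual X j (\<gamma> j)"
  have "column j X = r + (\<Sum>k\<in>- {j}. \<gamma> j k *\<^sub>R column k X)"
    by (simp add: r_def node_residual_def)
  then have "(column j X \<bullet> r) / real CARD('n)
      = (norm_n r)\<^sup>2 + (r \<bullet> (\<Sum>k\<in>- {j}. \<gamma> j k *\<^sub>R column k X)) / real CARD('n)"
    by (simp add: norm_n_square inner_add_left inner_add_right add_divide_distrib inner_commute)
  also have "\<dots> = (tau_hat X \<gamma> j)\<^sup>2 + lam * tau_hat X \<gamma> j * node_l1 j (\<gamma> j)"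
    using sqrt_node_lasso_inner_fitted[OF lasso] pos by (simp add: r_def tau_hat_def)
  also have "\<dots> = (tau_tilde lam X \<gamma> j)\<^sup>2"
    unfolding tau_tilde_def using \<open>0 \<le> lam\<close> pos
    by (subst real_sqrt_pow2) (auto simp: node_l1_def sum_nonneg)
  finally show ?thesis
    by (simp add: r_def)
qed

lemma max_norm_gram_mult_Theta_hat_le:
  fixes X :: "real^'p^'n"
  assumes lasso: "\<And>j. is_sqrt_node_lasso lam X j (\<gamma> j)" and "0 \<le> lam"
    and nz: "\<And>j. tau_hat X \<gamma> j \<noteq> 0"
  shows "max_norm (gram X ** Theta_hat lam X \<gamma> - mat 1)
    \<le> lam * max_norm (matrix_inv (tau_tilde_mat lam X \<gamma>))"
proof (rule max_norm_le)
  fix k j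
  let ?t = "tau_tilde lam X \<gamma>"
  have hat: "0 < tau_hat X \<gamma> j" for j
    using nz[of j] norm_n_nonneg unfolding tau_hat_def by (metis less_eq_real_def)
  then have tilde: "0 < ?t j" for j
    using tau_hat_le_tau_tilde[OF \<open>0 \<le> lam\<close>] by (rule less_le_trans)
  then have nz_tilde: "?t j \<noteq> 0" for j
    by (metis less_irrefl)
  have "(gram X ** Theta_hat lam X \<gamma>) $ k $ j
      = (gram X ** C_hat \<gamma>) $ k $ j * (1 / (?t j * ?t j))"
    by (simp add: Theta_hat_def tau_tilde_mat_def diag_mat_mult matrix_inv_diag_mat nz_tilde
        matrix_mul_assoc matrix_mult_diag_mat)
  then have entry: "(gram X ** Theta_hat lam X \<gamma>) $ k $ j
      = (column k X \<bullet> node_residual X j (\<gamma> j)) / real CARD('n) / (?t j)\<^sup>2"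
    by (simp add: gram_mult_C_hat power2_eq_square)
  \<comment> \<open>The reciprocal is the \<open>j\<close>-th diagonal entry of the inverse diagonal
    matrix.\<close>
  have inv: "1 / ?t j \<le> max_norm (matrix_inv (tau_tilde_mat lam X \<gamma>))"
    using abs_entry_le_max_norm[of "matrix_inv (tau_tilde_mat lam X \<gamma>)" j j] tilde[of j]
    unfolding tau_tilde_mat_def matrix_inv_diag_mat[OF nz_tilde] by (simp add: diag_mat_def)
  show "\<bar>(gram X ** Theta_hat lam X \<gamma> - mat 1) $ k $ j\<bar>
      \<le> lam * max_norm (matrix_inv (tau_tilde_mat lam X \<gamma>))"
  proof (cases "k = j")
    case True
    have "(gram X ** Theta_hat lam X \<gamma>) $ j $ j = 1"
      using entry nz_tilde[of j] unfolding True
      by (simp add: sqrt_node_lasso_inner_own_column[where \<gamma> = \<gamma>, OF lasso \<open>0 \<le> lam\<close> hat])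
    then show ?thesis
      using True \<open>0 \<le> lam\<close> by (simp add: mat_def max_norm_nonneg)
  next
    case False
    have "\<bar>(gram X ** Theta_hat lam X \<gamma> - mat 1) $ k $ j\<bar>
        = \<bar>node_residual X j (\<gamma> j) \<bullet> column k X\<bar> / real CARD('n) / (?t j)\<^sup>2"
      using False by (simp add: mat_def entry abs_divide inner_commute)
    also have "\<dots> \<le> lam * tau_hat X \<gamma> j / (?t j)\<^sup>2"
      using sqrt_node_lasso_inner_column_le[OF lasso \<open>0 \<le> lam\<close> _ False] hat[of j]
      unfolding tau_hat_def by (intro divide_right_mono) auto
    \<comment> \<open>Enlarging \<open>tau_hat\<close> to \<open>tau_tilde\<close> lets one factor
      of the denominator cancel.\<close>
    also have "\<dots> \<le> lam * ?t j / (?t j)\<^sup>2"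
      using tau_hat_le_tau_tilde[OF \<open>0 \<le> lam\<close>, of X \<gamma> j] \<open>0 \<le> lam\<close>
      by (intro divide_right_mono mult_left_mono) auto
    also have "\<dots> = lam * (1 / ?t j)"
      by (simp add: power2_eq_square)
    also have "\<dots> \<le> lam * max_norm (matrix_inv (tau_tilde_mat lam X \<gamma>))"
      by (intro mult_left_mono inv \<open>0 \<le> lam\<close>)
    finally show ?thesis .
  qed
qed

section \<open>Expansion of the de-sparsified estimator\<close>

text \<open>The first two products on the right combine to
  \<open>- (transpose T ** (S - Sigma0) ** Theta0)\<close>, which is
  \<open>transpose T - transpose T ** S ** Theta0\<close>. Expanding the last product cancels the
  mixed term and leaves the left-hand side.\<close>

lemma desparse_expansion:
  fixes T S Sigma0 Theta0 :: "real^'p^'p"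
  assumes "Sigma0 ** Theta0 = mat 1"
  shows "T + transpose T - transpose T ** S ** T - Theta0
    = - (Theta0 ** (S - Sigma0) ** Theta0) - (transpose T - Theta0) ** (S - Sigma0) ** Theta0
      - (transpose T ** S - mat 1) ** (T - Theta0)"
proof -
  have "A ** Sigma0 ** Theta0 = A" for A :: "real^'p^'p"
    using assms by (simp add: matrix_mul_assoc[symmetric])
  then show ?thesis
    by (simp add: matrix_diff_ldistrib matrix_diff_rdistrib matrix_mul_assoc)
qed

theorem lemma2p6p2:
  fixes M :: "'w measure" and X :: "'w \<Rightarrow> real^'p^'n"
    and N :: "'v measure" and X0 :: "'v \<Rightarrow> real^'p"
    and lam :: real and \<gamma> :: "'w \<Rightarrow> 'p \<Rightarrow> 'p \<Rightarrow> real"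
  assumes "prob_space M" and "prob_space N"
    and "X0 \<in> borel_measurable N"
    and rows_indep: "prob_space.indep_vars M (\<lambda>_. borel) (\<lambda>i \<omega>. X \<omega> $ i) UNIV"
    and rows_copies: "\<And>i. distr M borel (\<lambda>\<omega>. X \<omega> $ i) = distr N borel X0"
    and second_moments: "\<And>k l. integrable N (\<lambda>\<omega>. X0 \<omega> $ k * X0 \<omega> $ l)"
    and Sigma0_invertible: "invertible (second_moment N X0)"
    and "lam > 0"
    and estimator: "\<And>\<omega> j. \<omega> \<in> space M \<Longrightarrow> is_sqrt_node_lasso lam (X \<omega>) j (\<gamma> \<omega> j)"
  shows "\<exists>rem1 rem2 :: 'w \<Rightarrow> real^'p^'p. \<forall>\<omega>\<in>space M.
    (\<forall>j. tau_hat (X \<omega>) (\<gamma> \<omega>) j \<noteq> 0) \<longrightarrow>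
    (let Sigma0 = second_moment N X0;
         Theta0 = matrix_inv Sigma0;
         W = gram (X \<omega>) - Sigma0;
         Theta = Theta_hat lam (X \<omega>) (\<gamma> \<omega>)
     in Theta_desparse lam (X \<omega>) (\<gamma> \<omega>) - Theta0
          = - (Theta0 ** W ** Theta0) - rem1 \<omega> - rem2 \<omega>
      \<and> max_norm (rem1 \<omega>) \<le> max_norm (Theta0 ** W) * col_sum_norm (Theta - Theta0)
      \<and> max_norm (rem2 \<omega>)
          \<le> lam * max_norm (matrix_inv (tau_tilde_mat lam (X \<omega>) (\<gamma> \<omega>)))
              * col_sum_norm (Theta - Theta0))"
proof -
  define Sigma0 where "Sigma0 = second_moment N X0"
  define Theta0 where "Theta0 = matrix_inv Sigma0"
  define S where "S = (\<lambda>\<omega>. gram (X \<omega>))"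
  define T where "T = (\<lambda>\<omega>. Theta_hat lam (X \<omega>) (\<gamma> \<omega>))"
  have inv: "Sigma0 ** Theta0 = mat 1"
    using Sigma0_invertible by (simp add: Sigma0_def Theta0_def matrix_inv_right)
  have sym: "transpose Sigma0 = Sigma0" "transpose Theta0 = Theta0" "transpose (S \<omega>) = S \<omega>" for \<omega>
    using Sigma0_invertible
    by (simp_all add: Sigma0_def Theta0_def S_def transpose_gram transpose_second_moment
        transpose_matrix_inv_symmetric)
  define rem1 where "rem1 = (\<lambda>\<omega>. (transpose (T \<omega>) - Theta0) ** (S \<omega> - Sigma0) ** Theta0)"
  define rem2 where "rem2 = (\<lambda>\<omega>. (transpose (T \<omega>) ** S \<omega> - mat 1) ** (T \<omega> - Theta0))"
  \<comment> \<open>By symmetry of all three matrices, transposing moves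
    \<open>Theta0 ** (S \<omega> - Sigma0)\<close> to the left, where the product bound takes its
    max norm; \<open>max_norm\<close> is invariant under transposition.\<close>
  have "rem1 \<omega> = transpose (Theta0 ** (S \<omega> - Sigma0) ** (T \<omega> - Theta0))" for \<omega>
    by (simp add: rem1_def matrix_transpose_mul transpose_diff sym matrix_mul_assoc)
  then have rem1: "max_norm (rem1 \<omega>)
      \<le> max_norm (Theta0 ** (S \<omega> - Sigma0)) * col_sum_norm (T \<omega> - Theta0)" for \<omega>
    by (simp add: max_norm_transpose max_norm_matrix_mult_le)
  \<comment> \<open>Optimality of the Lasso enters here, pointwise in \<omega>, through the bound on
    \<open>S \<omega> ** T \<omega> - mat 1\<close>.\<close>
  have rem2: "max_norm (rem2 \<omega>)
      \<le> lam * max_norm (matrix_inv (tau_tilde_mat lam (X \<omega>) (\<gamma> \<omega>))) * col_sum_norm (T \<omega> - Theta0)"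
    if "\<omega> \<in> space M" "\<And>j. tau_hat (X \<omega>) (\<gamma> \<omega>) j \<noteq> 0" for \<omega>
  proof -
    have "transpose (T \<omega>) ** S \<omega> - mat 1 = transpose (S \<omega> ** T \<omega> - mat 1)"
      by (simp add: matrix_transpose_mul transpose_diff sym)
    then have "max_norm (rem2 \<omega>) \<le> max_norm (S \<omega> ** T \<omega> - mat 1) * col_sum_norm (T \<omega> - Theta0)"
      unfolding rem2_def by (metis max_norm_matrix_mult_le max_norm_transpose)
    also have "\<dots> \<le> lam * max_norm (matrix_inv (tau_tilde_mat lam (X \<omega>) (\<gamma> \<omega>)))
        * col_sum_norm (T \<omega> - Theta0)"
      unfolding S_def T_def using that estimator \<open>lam > 0\<close>
      by (intro mult_right_mono max_norm_gram_mult_Theta_hat_le col_sum_norm_nonneg) auto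
    finally show ?thesis .
  qed
  have "Theta_desparse lam (X \<omega>) (\<gamma> \<omega>) - Theta0
      = - (Theta0 ** (S \<omega> - Sigma0) ** Theta0) - rem1 \<omega> - rem2 \<omega>" for \<omega>
    unfolding Theta_desparse_def rem1_def rem2_def S_def T_def by (rule desparse_expansion[OF inv])
  then show ?thesis
    using rem1 rem2 unfolding Let_def Sigma0_def Theta0_def S_def T_def
    by (intro exI[of _ rem1] exI[of _ rem2]) auto
qed

end
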